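(* Let $B=(\mathbf b_1,\mathbf b_2,\mathbf b_3)$ be a basis of a full-rank lattice $\Lambda\subset\mathbb R^3$, and let $K\subset\mathbb R^3$ be a centrally symmetric convex body. If $$X_{123}(K;B)\ne\varnothing,\qquad X_{132}(K;B)\ne\varnothing,\qquad X_{213}(K;B)\ne\varnothing,$$ then $K+\Lambda=\mathbb R^3$.
   Context: A convex body is a compact convex set with nonempty interior; it is centrally symmetric if it is symmetric about some point (not necessarily the origin). For $\sigma\in S_3$, $$X_\sigma(K;B)=K\cap(K-\mathbf b_{\sigma(1)})\cap(K-\mathbf b_{\sigma(1)}-\mathbf b_{\sigma(2)})\cap(K-\mathbf b_1-\mathbf b_2-\mathbf b_3),$$ and the subscript $ijk$ denotes the permutation $\sigma$ with $(\sigma(1),\sigma(2),\sigma(3))=(i,j,k)$. *)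

theory Defs
  imports "HOL-Analysis.Analysis"
begin

definition convex_body :: "'a::euclidean_space set \<Rightarrow> bool" where
  "convex_body K \<longleftrightarrow> convex K \<and> compact K \<and> interior K \<noteq> {}"

text \<open>The centre \<open>c\<close> is an arbitrary point, not necessarily the origin.\<close>

definition centrally_symmetric :: "'a::real_vector set \<Rightarrow> bool" where
  "centrally_symmetric K \<longleftrightarrow> (\<exists>c. (\<lambda>x. 2 *\<^sub>R c - x) ` K = K)"

text \<open>Full rank is built in: the index type of the basis is that of the coordinates, so
  \<open>\<Lambda>\<close> is generated over the integers by \<open>CARD('n)\<close> linearly independent vectors.
  Injectivity is needed because \<open>independent (range b)\<close> ignores repetitions.\<close>

definition full_rank_lattice_basis :: "('n::finite \<Rightarrow> real^'n) \<Rightarrow> (real^'n) set \<Rightarrow> bool" where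
  "full_rank_lattice_basis b \<Lambda> \<longleftrightarrow>
     inj b \<and> independent (range b) \<and>
     \<Lambda> = range (\<lambda>z :: 'n \<Rightarrow> int. \<Sum>i\<in>UNIV. of_int (z i) *\<^sub>R b i)"

text \<open>\<open>perm3 i j k\<close> sends \<open>1, 2, 3\<close> to \<open>i, j, k\<close>. In the index type \<open>3\<close> the numeral \<open>3\<close> is
  the same element as \<open>0\<close>, and \<open>1, 2, 3\<close> are its three elements.\<close>

definition perm3 :: "3 \<Rightarrow> 3 \<Rightarrow> 3 \<Rightarrow> 3 \<Rightarrow> 3" where
  "perm3 i j k m = (if m = 1 then i else if m = 2 then j else k)"

definition X :: "(3 \<Rightarrow> 3) \<Rightarrow> (real^3) set \<Rightarrow> (3 \<Rightarrow> real^3) \<Rightarrow> (real^3) set" where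
  "X \<sigma> K b =
     K \<inter> (\<lambda>x. x - b (\<sigma> 1)) ` K
       \<inter> (\<lambda>x. x - b (\<sigma> 1) - b (\<sigma> 2)) ` K
       \<inter> (\<lambda>x. x - b 1 - b 2 - b 3) ` K"

end

theory Submission
  imports Defs
begin

text \<open>
  The condition \<open>X (perm3 i j k) K b \<noteq> {}\<close> says that \<open>K\<close> contains a translate of the
  tetrahedron with vertices \<open>0\<close>, \<open>b i\<close>, \<open>b i + b j\<close>, \<open>b i + b j + b k\<close>. Reflection in the
  centre of \<open>K\<close> turns such a translate into one for the reversed order \<open>k, j, i\<close>, so the three
  hypotheses provide all six orders. The lattice translates of these six tetrahedra triangulate
  space (the Kuhn triangulation), and the hypotheses say that the nerve of the family
  \<open>K - l\<close>, with \<open>l \<in> \<Lambda>\<close>, contains this triangulation: for every tetrahedron \<open>T\<close> the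
  sets \<open>K - l\<close>, with \<open>l\<close> a vertex of \<open>T\<close>, have a common point \<open>q\<^sub>T\<close>.

  Averaging the points \<open>q\<^sub>T\<close> over the tetrahedra near \<open>x\<close> would give a continuous map at bounded
  distance from \<open>- x\<close>, hence a surjective one by Brouwer's theorem. All tetrahedra very close to
  \<open>x\<close> share a vertex \<open>l\<close>, so by convexity the average lies in \<open>K - l\<close>, and surjectivity is the
  claim. Here the averaging is packaged into a fixed point theorem for convex-valued maps with local
  continuous selections (\<open>fixed_point_of_convex_valued_map\<close>). The common vertex comes from
  cyclic gaps: the barycentric coordinates of \<open>x\<close> in its tetrahedron are the lengths of the arcs
  into which \<open>0\<close> and the lattice coordinates of \<open>x\<close>, taken modulo 1, divide a circle of
  length 1. Cutting the circle inside a long arc singles out a vertex whose barycentric coordinate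
  is bounded below by a constant (\<open>integer_shift_into_short_interval\<close>). This vertex
  belongs to every tetrahedron that meets a neighbourhood of \<open>x\<close> of fixed size.

  The argument works in every dimension (\<open>translates_cover_of_level_sums\<close>).
\<close>

section \<open>A fixed point theorem for convex-valued maps\<close>

text \<open>
  A partition of unity glues the local selections to a global continuous one, whose values stay in
  \<open>F x \<inter> C\<close> because these sets are convex; Brouwer's theorem applies to it.
\<close>

lemma fixed_point_of_convex_valued_map:
  fixes C :: "'a::euclidean_space set" and F :: "'a \<Rightarrow> 'a set"
  assumes C: "compact C" "convex C" "C \<noteq> {}"
    and convex_values: "\<And>x. x \<in> C \<Longrightarrow> convex (F x)"
    and local_selection: "\<And>x. x \<in> C \<Longrightarrow>
      \<exists>U f. open U \<and> x \<in> U \<and> continuous_on C f \<and> (\<forall>y\<in>U \<inter> C. f y \<in> F y \<inter> C)"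
  shows "\<exists>x\<in>C. x \<in> F x"
proof -
  define selects where
    "selects U f \<longleftrightarrow> continuous_on C f \<and> (\<forall>y\<in>U \<inter> C. f y \<in> F y \<inter> C)" for U f
  define \<U> where "\<U> = {U. open U \<and> (\<exists>f. selects U f)}"
  have "C \<subseteq> \<Union>\<U>"
    using local_selection unfolding \<U>_def selects_def by blast
  moreover have "open U" if "U \<in> \<U>" for U
    using that by (simp add: \<U>_def)
  ultimately obtain \<V> where \<V>: "\<V> \<subseteq> \<U>" "finite \<V>" "C \<subseteq> \<Union>\<V>"
    using compactE[OF C(1), of \<U>] by metis
  have "\<forall>U\<in>\<V>. \<exists>f. selects U f"
    using \<V>(1) by (auto simp: \<U>_def)
  then obtain f where f: "\<And>U. U \<in> \<V> \<Longrightarrow> selects U (f U)"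
    by metis
  obtain w :: "'a set \<Rightarrow> 'a \<Rightarrow> real" where
    w: "\<And>U. U \<in> \<V> \<Longrightarrow> continuous_on C (w U) \<and> (\<forall>x\<in>C. 0 \<le> w U x)"
    and w0: "\<And>x U. U \<in> \<V> \<Longrightarrow> x \<in> C \<Longrightarrow> x \<notin> U \<Longrightarrow> w U x = 0"
    and w1: "\<And>x. x \<in> C \<Longrightarrow> supp_sum (\<lambda>U. w U x) \<V> = 1"
  proof (rule subordinate_partition_of_unity[of C \<V>])
    show "open U" if "U \<in> \<V>" for U
      using that \<V>(1) by (auto simp: \<U>_def)
    show "\<exists>V. open V \<and> x \<in> V \<and> finite {U \<in> \<V>. U \<inter> V \<noteq> {}}" for x
      using \<V>(2) by (intro exI[of _ UNIV]) auto
  qed (use \<V>(3) in blast)+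
  have sum_w: "(\<Sum>U\<in>\<V>. w U x) = 1" if "x \<in> C" for x
  proof -
    have "supp_sum (\<lambda>U. w U x) \<V> = (\<Sum>U\<in>\<V>. w U x)"
      unfolding supp_sum_def support_on_def
      using \<V>(2) by (intro sum.mono_neutral_left) auto
    with w1[OF that] show ?thesis by simp
  qed
  define g where "g x = (\<Sum>U\<in>\<V>. w U x *\<^sub>R f U x)" for x
  have g: "g x \<in> F x \<inter> C" if x: "x \<in> C" for x
  proof -
    let ?W = "{U \<in> \<V>. x \<in> U}"
    have "g x = (\<Sum>U\<in>?W. w U x *\<^sub>R f U x)"
      unfolding g_def using \<V>(2) w0 x by (intro sum.mono_neutral_right) auto
    moreover have "(\<Sum>U\<in>?W. w U x) = (\<Sum>U\<in>\<V>. w U x)"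
      using \<V>(2) w0 x by (intro sum.mono_neutral_left) auto
    moreover have "f U x \<in> F x \<inter> C" if "U \<in> ?W" for U
      using f[of U] that x by (auto simp: selects_def)
    ultimately show ?thesis
      using convex_sum[of ?W "F x \<inter> C" "\<lambda>U. w U x" "\<lambda>U. f U x"] \<V>(2) w x sum_w[OF x]
        convex_Int[OF convex_values[OF x] C(2)]
      by auto
  qed
  have "continuous_on C g"
    unfolding g_def using w f by (intro continuous_intros) (auto simp: selects_def)
  then obtain x where "x \<in> C" "g x = x"
    using brouwer[OF C, of g] g by blast
  then show ?thesis using g by force
qed

section \<open>Covering by lattice translates in any dimension\<close>

text \<open>
  Modulo 1 the numbers \<open>a i\<close> together with \<open>0\<close> are at most \<open>n + 1\<close> points of a circle, so one of
  the \<open>n + 2\<close> arcs of length \<open>d\<close> contains none of them. Cutting the circle open along this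
  arc places all of them in an interval of length \<open>1 - d\<close>.
\<close>

lemma integer_shift_into_short_interval:
  fixes a :: "'n::finite \<Rightarrow> real"
  defines "d \<equiv> 1 / (of_nat CARD('n) + 2)"
  shows "\<exists>(v :: 'n \<Rightarrow> int) s. s \<le> 0 \<and> 0 \<le> s + 1 - d \<and>
           (\<forall>i. s \<le> a i - v i \<and> a i - v i \<le> s + 1 - d)"
proof -
  define N :: nat where "N = CARD('n) + 2"
  have d: "d = 1 / N" "N > 0" "d > 0" by (auto simp: d_def N_def)
  \<comment> \<open>Arc \<open>0\<close> is excluded from the search because it contains the point \<open>0\<close>.\<close>
  let ?arc = "\<lambda>i. nat \<lfloor>N * frac (a i)\<rfloor>"
  have "card (range ?arc) \<le> CARD('n)"
    by (rule card_image_le) simp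
  also have "\<dots> < card {1..<N}" by (simp add: N_def)
  finally have "\<not> {1..<N} \<subseteq> range ?arc"
    using card_mono[of "range ?arc" "{1..<N}"] by auto
  then obtain k where "k \<in> {1..<N}" "k \<notin> range ?arc" by blast
  then have k: "1 \<le> k" "k < N" "\<And>i. ?arc i \<noteq> k" by auto
  define s where "s = (k + 1) / N - 1"
  have "real k + 1 \<le> N" using k(2) by linarith
  then have s: "s \<le> 0" "s + 1 - d = k / N"
    using d by (simp_all add: s_def add_divide_distrib[symmetric] diff_divide_distrib[symmetric])
  define v where "v i = (if frac (a i) < k / N then \<lfloor>a i\<rfloor> else \<lfloor>a i\<rfloor> + 1)" for i
  have "s \<le> a i - v i \<and> a i - v i \<le> s + 1 - d" for i
  proof (cases "frac (a i) < k / N")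
    case True
    then have "a i - v i = frac (a i)" by (simp add: v_def frac_def)
    then show ?thesis using True s frac_ge_0[of "a i"] by linarith
  next
    case False
    then have "real k \<le> N * frac (a i)" using d by (simp add: field_simps)
    then have "int k \<le> \<lfloor>N * frac (a i)\<rfloor>" by (simp add: le_floor_iff)
    with k(3)[of i] have "int k + 1 \<le> \<lfloor>N * frac (a i)\<rfloor>" by linarith
    then have "real k + 1 \<le> N * frac (a i)" by (simp add: le_floor_iff)
    then have "(k + 1) / N \<le> frac (a i)" using d by (simp add: field_simps)
    moreover have "0 \<le> k / N" by simp
    moreover have "a i - v i = frac (a i) - 1" using False by (simp add: v_def frac_def)
    moreover have "s = (k + 1) / N - 1" by (fact s_def)
    ultimately show ?thesis using s(2) frac_lt_1[of "a i"] by linarith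
  qed
  moreover have "0 \<le> s + 1 - d" using s by simp
  ultimately show ?thesis using s(1) by blast
qed

lemma lattice_basis_coordinates:
  assumes "full_rank_lattice_basis b \<Lambda>"
  obtains c :: "real^'n \<Rightarrow> 'n::finite \<Rightarrow> real" where
    "\<And>i. continuous_on UNIV (\<lambda>x. c x i)" "\<And>x. x = (\<Sum>i\<in>UNIV. c x i *\<^sub>R b i)"
proof -
  have inj: "inj b" and ind: "independent (range b)"
    using assms by (auto simp: full_rank_lattice_basis_def)
  have span: "span (range b) = UNIV"
    using card_eq_dim[of "range b" UNIV] ind card_image[OF inj] by (auto simp: dim_UNIV)
  define c where "c x i = representation (range b) x (b i)" for x i
  have "linear (\<lambda>x. c x i)" for i
    unfolding c_def
    by (intro linearI) (simp_all add: representation_add representation_scale ind span)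
  then have "continuous_on UNIV (\<lambda>x. c x i)" for i
    by (rule linear_continuous_on[OF linear_conv_bounded_linear[THEN iffD1]])
  moreover have "x = (\<Sum>i\<in>UNIV. c x i *\<^sub>R b i)" for x
  proof -
    have "x = (\<Sum>v\<in>range b. representation (range b) x v *\<^sub>R v)"
      using sum_representation_eq[OF ind, of x "range b"] span by simp
    also have "\<dots> = (\<Sum>i\<in>UNIV. c x i *\<^sub>R b i)"
      by (simp add: sum.reindex[OF inj] c_def)
    finally show ?thesis .
  qed
  ultimately show ?thesis using that by blast
qed

text \<open>
  The last assumption states the presence of all Kuhn simplices without permutations: the sets
  \<open>{i. t < y i}\<close> are initial segments of the order of the indices by decreasing \<open>y\<close>, so \<open>q\<close> is
  the base of a translate of the simplex for that order, or of one of its faces if \<open>y\<close> has ties.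
  In the proof \<open>y\<close> consists of the fractional parts of the coordinates of a point \<open>x\<close>; the
  simplex that it describes, moved to the lattice point of the integer parts, is a face of the
  triangulation that contains \<open>x\<close>.
\<close>

lemma translates_cover_of_level_sums:
  fixes b :: "'n::finite \<Rightarrow> real^'n"
  assumes basis: "full_rank_lattice_basis b \<Lambda>"
    and K: "convex K" "bounded K"
    and level_sums: "\<And>y :: 'n \<Rightarrow> real. \<exists>q. \<forall>t. q + (\<Sum>i | t < y i. b i) \<in> K"
  shows "K + \<Lambda> = UNIV"
proof -
  define L where "L z = (\<Sum>i\<in>UNIV. of_int (z i) *\<^sub>R b i)" for z :: "'n \<Rightarrow> int"
  have \<Lambda>: "\<Lambda> = range L"
    using basis by (simp add: full_rank_lattice_basis_def L_def)
  obtain c where c_cont: "\<And>i. continuous_on UNIV (\<lambda>x. c x i)"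
    and c: "\<And>x. x = (\<Sum>i\<in>UNIV. c x i *\<^sub>R b i)"
    using lattice_basis_coordinates[OF basis] by blast
  define d :: real where "d = 1 / (of_nat CARD('n) + 2)"
  have d: "0 < d" "d < 1" by (auto simp: d_def)
  have "\<forall>x. \<exists>(v :: 'n \<Rightarrow> int) s. s \<le> 0 \<and> 0 \<le> s + 1 - d \<and>
      (\<forall>i. s \<le> c x i - v i \<and> c x i - v i \<le> s + 1 - d)"
    using integer_shift_into_short_interval unfolding d_def by blast
  then obtain v :: "real^'n \<Rightarrow> 'n \<Rightarrow> int" and s where v: "\<And>x. s x \<le> 0" "\<And>x. 0 \<le> s x + 1 - d"
      "\<And>x i. s x \<le> c x i - v x i" "\<And>x i. c x i - v x i \<le> s x + 1 - d"
    by metis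
  obtain M where M: "\<And>k. k \<in> K \<Longrightarrow> norm k \<le> M"
    using K(2) by (auto simp: bounded_iff)
  have "p \<in> K + \<Lambda>" for p
  proof -
    \<comment> \<open>A fixed point \<open>x = x - p - L (v x) + k\<close> is a representation \<open>p = k - L (v x)\<close>.
      Adding \<open>x - p\<close> to \<open>k - L (v x)\<close> cancels its drift \<open>- x\<close>, so that the selections stay in
      a ball around \<open>- p\<close>.\<close>
    define C where "C = cball (- p) (M + (\<Sum>i\<in>UNIV. 2 * norm (b i)))"
    define F where "F x = (\<lambda>k. (x - p - L (v x)) + k) ` K" for x
    have "\<exists>x\<in>C. x \<in> F x"
    proof (rule fixed_point_of_convex_valued_map)
      show "compact C" "convex C" by (auto simp: C_def)
      obtain q where "q \<in> K" using level_sums[of "\<lambda>_. 0"] by blast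
      then have "0 \<le> M" using M[of q] norm_ge_zero[of q] by linarith
      then show "C \<noteq> {}" by (simp add: C_def sum_nonneg add_nonneg_nonneg not_less)
      show "convex (F x)" for x
        unfolding F_def by (rule convex_translation[OF K(1)])
    next
      fix x
      define u where "u i = \<lfloor>c x i\<rfloor>" for i
      define y where "y i = c x i - u i" for i
      have y: "0 \<le> y i" "y i < 1" for i
        unfolding y_def u_def by linarith+
      obtain q where q: "\<And>t. q + (\<Sum>i | t < y i. b i) \<in> K"
        using level_sums by blast
      have "{i. 1 < y i} = {}" using y by (auto simp: not_less less_imp_le)
      with q[of 1] have qK: "q \<in> K" by simp
      define U where "U = (\<Inter>i. {x'. \<bar>c x' i - c x i\<bar> < d / 2})"
      define f where "f x' = (x' - p - L u) + q" for x'
      have "open U"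
        unfolding U_def by (intro open_INT ballI open_Collect_less continuous_intros c_cont) auto
      moreover have "x \<in> U" using d by (simp add: U_def)
      moreover have "continuous_on C f" unfolding f_def by (intro continuous_intros)
      moreover have "f x' \<in> F x' \<inter> C" if "x' \<in> U" for x'
      proof -
        have close: "\<bar>c x' i - c x i\<bar> < d / 2" for i
          using that by (auto simp: U_def)
        \<comment> \<open>The vertex chosen at \<open>x'\<close> belongs to the simplex chosen at \<open>x\<close>: relative to the base
          point \<open>u\<close> it is the indicator function of a level set of \<open>y\<close>.\<close>
        define m where "m i = v x' i - u i" for i
        have m01: "m i = 0 \<or> m i = 1" for i
        proof -
          have "real_of_int (m i) < 2" "-1 < real_of_int (m i)"
            using v(1,2)[of x'] v(3,4)[of x' i] y[of i] close[of i] d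
            unfolding m_def y_def of_int_diff abs_less_iff by linarith+
          then show ?thesis by linarith
        qed
        have upper: "y j < y i" if "m i = 1" "m j = 0" for i j
        proof -
          have "real_of_int (v x' i) = u i + 1" "real_of_int (v x' j) = u j"
            using that unfolding m_def by linarith+
          then show ?thesis
            using v(3)[of x' i] v(4)[of x' j] close[of i] close[of j]
            unfolding y_def abs_less_iff by linarith
        qed
        \<comment> \<open>The value \<open>-1\<close> lies below all \<open>y i\<close> and covers the case that \<open>m\<close> is constantly 1.\<close>
        define t where "t = Max (insert (-1) (y ` {j. m j = 0}))"
        have "m i = (if t < y i then 1 else 0)" for i
        proof (cases "m i = 0")
          case True
          then have "y i \<le> t" unfolding t_def by (intro Max_ge) auto
          then show ?thesis using True by simp
        next
          case False
          then have "m i = 1" using m01 by blast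
          moreover have "t < y i"
            unfolding t_def using upper[OF \<open>m i = 1\<close>] y(1)[of i]
            by (subst Max_less_iff) auto
          ultimately show ?thesis by simp
        qed
        then have "L m = (\<Sum>i\<in>UNIV. if t < y i then b i else 0)"
          unfolding L_def by (intro sum.cong) auto
        also have "\<dots> = (\<Sum>i | t < y i. b i)"
          by (simp add: sum.If_cases)
        finally have "q + L m \<in> K" using q[of t] by simp
        moreover have "L m = L (v x') - L u"
          by (simp add: L_def m_def scaleR_diff_left sum_subtractf)
        then have "f x' = (x' - p - L (v x')) + (q + L m)" by (simp add: f_def)
        ultimately have "f x' \<in> F x'" unfolding F_def by (intro image_eqI)
        moreover have "f x' \<in> C"
        proof -
          have "f x' + p = q + (x' - L u)" by (simp add: f_def)
          also have "x' - L u = (\<Sum>i\<in>UNIV. (c x' i - u i) *\<^sub>R b i)"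
            by (subst c[of x']) (simp add: L_def scaleR_diff_left sum_subtractf)
          finally have "norm (f x' + p) \<le> norm q + norm (\<Sum>i\<in>UNIV. (c x' i - u i) *\<^sub>R b i)"
            by (simp add: norm_triangle_ineq)
          also have "\<dots> \<le> M + (\<Sum>i\<in>UNIV. 2 * norm (b i))"
          proof (rule add_mono[OF M[OF qK]], rule sum_norm_le)
            fix i
            have "\<bar>c x' i - u i\<bar> \<le> 2"
              using y[of i] close[of i] d unfolding y_def by linarith
            then show "norm ((c x' i - u i) *\<^sub>R b i) \<le> 2 * norm (b i)"
              by (simp add: mult_right_mono)
          qed
          also have "norm (f x' + p) = dist (- p) (f x')"
            by (simp add: dist_norm norm_minus_commute[of "- p"])
          finally show ?thesis by (simp add: C_def)
        qed
        ultimately show ?thesis by blast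
      qed
      ultimately show "\<exists>U f. open U \<and> x \<in> U \<and> continuous_on C f \<and> (\<forall>y\<in>U \<inter> C. f y \<in> F y \<inter> C)"
        by blast
    qed
    then obtain x k where "k \<in> K" "x = (x - p - L (v x)) + k" by (auto simp: F_def)
    then have "p = k + L (\<lambda>i. - v x i)"
      by (simp add: L_def sum_negf algebra_simps)
    with \<open>k \<in> K\<close> show "p \<in> K + \<Lambda>" unfolding \<Lambda> by (auto intro: set_plus_intro)
  qed
  then show ?thesis by blast
qed

section \<open>Tetrahedra in centrally symmetric bodies\<close>

lemma X_perm3_nonempty_iff:
  assumes "{i, j, k} = UNIV"
  shows "X (perm3 i j k) K b \<noteq> {} \<longleftrightarrow>
    (\<exists>x. x \<in> K \<and> x + b i \<in> K \<and> x + b i + b j \<in> K \<and> x + b i + b j + b k \<in> K)"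
proof -
  have "b 1 + b 2 + b 3 = b i + b j + b k"
  proof -
    have "card {i, j, k} = 3" by (simp add: assms)
    then have "distinct [i, j, k]" using card_distinct[of "[i,j,k]"] by simp
    then have "sum b {i, j, k} = b i + b j + b k" by (simp add: add.assoc)
    then show ?thesis by (simp add: assms sum_3)
  qed
  then have total: "x + b 1 + b 2 + b 3 = x + b i + b j + b k" for x
    by (simp add: add.assoc)
  have "x \<in> (\<lambda>x. x - u) ` K \<longleftrightarrow> x + u \<in> K"
    "x \<in> (\<lambda>x. x - u - v) ` K \<longleftrightarrow> x + u + v \<in> K"
    "x \<in> (\<lambda>x. x - u - v - w) ` K \<longleftrightarrow> x + u + v + w \<in> K" for x u v w :: "real^3"
    by (auto simp: image_iff algebra_simps intro!: bexI[rotated])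
  then have "x \<in> X (perm3 i j k) K b \<longleftrightarrow>
      x \<in> K \<and> x + b i \<in> K \<and> x + b i + b j \<in> K \<and> x + b i + b j + b k \<in> K" for x
    unfolding total[symmetric] by (simp add: X_def perm3_def)
  then show ?thesis by blast
qed

text \<open>
  The reflection in the centre of \<open>K\<close> reverses the chain of vertices of the tetrahedron.
\<close>

lemma X_perm3_reverse:
  assumes "centrally_symmetric K" "{i, j, k} = UNIV" "X (perm3 i j k) K b \<noteq> {}"
  shows "X (perm3 k j i) K b \<noteq> {}"
proof -
  obtain x where x: "x \<in> K" "x + b i \<in> K" "x + b i + b j \<in> K" "x + b i + b j + b k \<in> K"
    using assms(3) X_perm3_nonempty_iff[OF assms(2)] by blast
  obtain c where "(\<lambda>x. 2 *\<^sub>R c - x) ` K = K"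
    using assms(1) by (auto simp: centrally_symmetric_def)
  then have refl: "2 *\<^sub>R c - x \<in> K" if "x \<in> K" for x
    using that by blast
  let ?y = "2 *\<^sub>R c - (x + b i + b j + b k)"
  have "?y \<in> K" "?y + b k \<in> K" "?y + b k + b j \<in> K" "?y + b k + b j + b i \<in> K"
    using x[THEN refl] by (simp_all add: algebra_simps)
  moreover have "{k, j, i} = UNIV" using assms(2) by auto
  ultimately show ?thesis using X_perm3_nonempty_iff by blast
qed

text \<open>
  Ordering the indices by decreasing \<open>y\<close> makes every level set an initial segment, so every
  level sum is a vertex of the tetrahedron for this order.
\<close>

lemma level_sums_of_X:
  fixes y :: "3 \<Rightarrow> real"
  assumes X: "\<And>i j k. {i, j, k} = UNIV \<Longrightarrow> X (perm3 i j k) K b \<noteq> {}"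
  shows "\<exists>q. \<forall>t. q + (\<Sum>i | t < y i. b i) \<in> K"
proof -
  have "\<exists>i j k. {i, j, k} = (UNIV :: 3 set) \<and> y k \<le> y j \<and> y j \<le> y i"
  proof -
    consider "y 3 \<le> y 2 \<and> y 2 \<le> y 1" | "y 2 \<le> y 3 \<and> y 3 \<le> y 1"
      | "y 3 \<le> y 1 \<and> y 1 \<le> y 2" | "y 1 \<le> y 3 \<and> y 3 \<le> y 2"
      | "y 2 \<le> y 1 \<and> y 1 \<le> y 3" | "y 1 \<le> y 2 \<and> y 2 \<le> y 3"
      by linarith
    then show ?thesis
      by cases (use UNIV_3 in \<open>blast+\<close>)
  qed
  then obtain i j k where ijk: "{i, j, k} = UNIV" "y k \<le> y j" "y j \<le> y i" by blast
  obtain q where q: "q \<in> K" "q + b i \<in> K" "q + b i + b j \<in> K" "q + b i + b j + b k \<in> K"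
    using X[OF ijk(1)] X_perm3_nonempty_iff[OF ijk(1)] by blast
  have "card {i, j, k} = 3" by (simp add: ijk(1))
  then have dist: "i \<noteq> j" "i \<noteq> k" "j \<noteq> k" using card_distinct[of "[i,j,k]"] by auto
  have levels: "{l. t < y l} \<in> {{}, {i}, {i, j}, {i, j, k}}" for t
  proof -
    have eq: "{l. t < y l} = {l \<in> {i, j, k}. t < y l}" by (simp add: ijk(1))
    have "y j \<le> t" if "y i \<le> t" using that ijk(3) by linarith
    moreover have "y k \<le> t" if "y j \<le> t" using that ijk(2) by linarith
    ultimately show ?thesis
      unfolding eq by (cases "t < y i"; cases "t < y j"; cases "t < y k") (auto simp: not_less)
  qed
  have "q + (\<Sum>l | t < y l. b l) \<in> K" for t
  proof -
    consider "{l. t < y l} = {}" | "{l. t < y l} = {i}" | "{l. t < y l} = {i, j}"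
      | "{l. t < y l} = {i, j, k}"
      using levels[of t] by blast
    then show ?thesis
      using q dist by cases (simp_all add: add.assoc)
  qed
  then show ?thesis by blast
qed

theorem corollary6p2:
  fixes b :: "3 \<Rightarrow> real^3" and \<Lambda> K :: "(real^3) set"
  assumes "full_rank_lattice_basis b \<Lambda>"
    and "convex_body K"
    and "centrally_symmetric K"
    and "X (perm3 1 2 3) K b \<noteq> {}"
    and "X (perm3 1 3 2) K b \<noteq> {}"
    and "X (perm3 2 1 3) K b \<noteq> {}"
  shows "K + \<Lambda> = UNIV"
proof (rule translates_cover_of_level_sums[OF assms(1)])
  show "convex K" "bounded K"
    using assms(2) by (auto simp: convex_body_def compact_imp_bounded)
  have U: "{1, 2, 3} = (UNIV :: 3 set)" "{1, 3, 2} = (UNIV :: 3 set)" "{2, 1, 3} = (UNIV :: 3 set)"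
    using UNIV_3 by blast+
  note reversed = X_perm3_reverse[OF assms(3) U(1) assms(4)]
    X_perm3_reverse[OF assms(3) U(2) assms(5)] X_perm3_reverse[OF assms(3) U(3) assms(6)]
  have "X (perm3 i j k) K b \<noteq> {}" if ijk: "{i, j, k} = UNIV" for i j k
  proof -
    have "card {i, j, k} = 3" by (simp add: ijk)
    then have "i \<noteq> j" "i \<noteq> k" "j \<noteq> k" using card_distinct[of "[i,j,k]"] by auto
    then have "(i, j, k) \<in> {(1,2,3), (1,3,2), (2,1,3), (3,2,1), (2,3,1), (3,1,2)}"
      using exhaust_3[of i] exhaust_3[of j] exhaust_3[of k] by auto
    then show ?thesis using assms(4-6) reversed by auto
  qed
  then show "\<exists>q. \<forall>t. q + (\<Sum>i | t < y i. b i) \<in> K" for y :: "3 \<Rightarrow> real"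
    by (rule level_sums_of_X)
qed

end
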